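(* Let $(A,B)$ be controllable. There is $\bar\beta\ge0$ depending only on $A,B,\mu_f,l_f,\mu_g,l_g,\bar\theta$ (in particular not on $N$) such that for every $Q\in\mathcal Q$, $R\in\mathcal R$ and $\theta$ with $\|\theta\|\le\bar\theta$, the vector $\beta^e=F(Q,R)\theta$ satisfies $\max(\bar\theta,\|\beta^e\|)\le\bar\beta$.
   Context: Fix $\mu_f,\mu_g>0$, $0<l_f,l_g<\infty$. $P^e(Q,R)$ denotes the positive definite solution of the DARE $P=Q+A^\top(P-PB(B^\top PB+R)^{-1}B^\top P)A$. $\mathcal Q=\{Q:\mu_fI_n\le Q\le l_fI_n\}$, $\mathcal R=\{R:\mu_gI_m\le R\le l_gI_m\}$. With $P^e=P^e(Q,R)$ and $K^e=(R+B^\top P^eB)^{-1}B^\top P^eA$, $F(Q,R)=(P^e)^{-1}(I-(A-BK^e)^\top)^{-1}Q$ (so that $\frac12(x-\beta^e)^\top P^e(x-\beta^e)$ is a bias function of the average-cost problem with stage cost $\frac12(x-\theta)^\top Q(x-\theta)+\frac12u^\top Ru$). *)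

theory Defs
  imports "HOL-Analysis.Analysis"
begin

(* matrix power (note: ^ on vec types is componentwise, so we define it separately) *)
primrec matpow :: "real^'n^'n \<Rightarrow> nat \<Rightarrow> real^'n^'n" where
  "matpow A 0 = mat 1"
| "matpow A (Suc k) = A ** matpow A k"

(* (A,B) controllable: the controllability matrix [B, AB, ..., A^(n-1) B] has rank n,
   i.e. its columns span R^n *)
definition controllable :: "real^'n^'n \<Rightarrow> real^'m^'n \<Rightarrow> bool" where
  "controllable A B \<longleftrightarrow>
     span (\<Union>k\<in>{..<CARD('n)}. range (\<lambda>j. column j (matpow A k ** B))) = UNIV"

definition symmetric_mat :: "real^'n^'n \<Rightarrow> bool" where
  "symmetric_mat M \<longleftrightarrow> transpose M = M"

definition pos_def :: "real^'n^'n \<Rightarrow> bool" where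
  "pos_def M \<longleftrightarrow> symmetric_mat M \<and> (\<forall>x. x \<noteq> 0 \<longrightarrow> x \<bullet> (M *v x) > 0)"

(* Loewner order on symmetric matrices: a I <= M <= b I *)
definition loewner_box :: "real \<Rightarrow> real \<Rightarrow> (real^'n^'n) set" where
  "loewner_box a b = {M. symmetric_mat M \<and>
      (\<forall>x. a * (x \<bullet> x) \<le> x \<bullet> (M *v x) \<and> x \<bullet> (M *v x) \<le> b * (x \<bullet> x))}"

(* the DARE  P = Q + A^T (P - P B (B^T P B + R)^{-1} B^T P) A *)
definition is_DARE_sol :: "real^'n^'n \<Rightarrow> real^'m^'n \<Rightarrow> real^'n^'n \<Rightarrow> real^'m^'m \<Rightarrow> real^'n^'n \<Rightarrow> bool" where
  "is_DARE_sol A B Q R P \<longleftrightarrow>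
     P = Q + transpose A ** (P - P ** B ** matrix_inv (transpose B ** P ** B + R) ** transpose B ** P) ** A"

(* P^e(Q,R): the positive definite solution of the DARE *)
definition Pe :: "real^'n^'n \<Rightarrow> real^'m^'n \<Rightarrow> real^'n^'n \<Rightarrow> real^'m^'m \<Rightarrow> real^'n^'n" where
  "Pe A B Q R = (THE P. pos_def P \<and> is_DARE_sol A B Q R P)"

definition Ke :: "real^'n^'n \<Rightarrow> real^'m^'n \<Rightarrow> real^'n^'n \<Rightarrow> real^'m^'m \<Rightarrow> real^'n^'m" where
  "Ke A B Q R = (let P = Pe A B Q R in matrix_inv (R + transpose B ** P ** B) ** transpose B ** P ** A)"

(* F(Q,R) = (P^e)^{-1} (I - (A - B K^e)^T)^{-1} Q *)
definition Fmat :: "real^'n^'n \<Rightarrow> real^'m^'n \<Rightarrow> real^'n^'n \<Rightarrow> real^'m^'m \<Rightarrow> real^'n^'n" where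
  "Fmat A B Q R = matrix_inv (Pe A B Q R) **
      matrix_inv (mat 1 - transpose (A - B ** Ke A B Q R)) ** Q"

end

theory Submission
  imports Defs
begin

text \<open>The DARE is the Bellman equation of the infinite-horizon LQ problem: completing the square
  shows that \<open>x \<bullet> (riccati P *v x)\<close> is the minimum over \<open>u\<close> of the one-step cost
  \<open>x \<bullet> Q x + u \<bullet> R u + (A x + B u) \<bullet> P (A x + B u)\<close>. Value iteration from \<open>0\<close> increases,
  and controllability bounds it: the states at which a family of cost-to-go forms stays bounded
  form a subspace from which no step of the system leads out, hence all of \<open>\<real>\<^sup>n\<close>. The limit
  is a positive definite solution, and comparing two solutions along the closed loop of one of them
  shows uniqueness, so \<open>P\<^sup>e\<close> is the value function. The same argument bounds
  \<open>P\<^sup>e(Q,R)\<close> by some \<open>c\<close> uniformly over the Loewner boxes.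

  The Bellman equation makes \<open>P\<^sup>e\<close> a Lyapunov function for the closed loop
  \<open>M = A - B K\<^sup>e\<close>, decreasing by at least \<open>\<mu>\<^sub>f \<parallel>x\<parallel>\<^sup>2\<close> per step; so \<open>M\<close> contracts the
  \<open>P\<^sup>e\<close>-norm by \<open>1 - \<mu>\<^sub>f / c\<close>, and \<open>(I - M)\<^sup>-\<^sup>1\<close>, hence \<open>(I - M\<^sup>T)\<^sup>-\<^sup>1\<close>, is bounded in terms
  of \<open>c / \<mu>\<^sub>f\<close> alone. With \<open>P\<^sup>e \<ge> \<mu>\<^sub>f I\<close> and the bound on \<open>Q\<close> this bounds \<open>F(Q,R) \<theta>\<close>.\<close>

declare transpose_matrix_vector[simp del]

section \<open>Quadratic forms and matrix inverses\<close>

definition qform :: "real^'n^'n \<Rightarrow> real^'n \<Rightarrow> real" where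
  "qform M x = x \<bullet> (M *v x)"

definition psd_mat :: "real^'n^'n \<Rightarrow> bool" where
  "psd_mat M \<longleftrightarrow> symmetric_mat M \<and> (\<forall>x. 0 \<le> qform M x)"

lemma inner_matrix_vector_transpose: "x \<bullet> ((M::real^'a^'b) *v y) = (transpose M *v x) \<bullet> y"
  by (simp add: dot_lmul_matrix transpose_matrix_vector)

lemma symmetric_inner_swap: "symmetric_mat P \<Longrightarrow> x \<bullet> (P *v y) = y \<bullet> (P *v x)"
  by (metis inner_commute inner_matrix_vector_transpose symmetric_mat_def)

lemma transpose_add: "transpose (M + N) = transpose M + transpose (N::real^'a^'b)"
  by (simp add: transpose_def vec_eq_iff)

lemma transpose_diff: "transpose (M - N) = transpose M - transpose (N::real^'a^'b)"
  by (simp add: transpose_def vec_eq_iff)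

lemma matrix_vector_mult_uminus_right: "(M::real^'a^'b) *v (- x) = - (M *v x)"
  by (simp add: vec_eq_iff matrix_vector_mult_def sum_negf)

lemma matrix_entry_inner_axis: "(M::real^'a^'b) $ i $ j = axis i 1 \<bullet> (M *v axis j 1)"
proof -
  have "M *v axis j 1 = column j M"
    by (simp add: column_def matrix_vector_mult_def axis_def vec_eq_iff if_distrib cong: if_cong)
  moreover have "axis i 1 \<bullet> v = v $ i" for v :: "real^'b"
    by (simp add: cart_eq_inner_axis inner_commute)
  ultimately show ?thesis
    by (simp add: column_def)
qed

lemma qform_0 [simp]: "qform M 0 = 0"
  by (simp add: qform_def)

lemma qform_uminus [simp]: "qform M (- x) = qform M x"
  by (simp add: qform_def matrix_vector_mult_uminus_right)

lemma qform_add: "qform M (x + y) = qform M x + x \<bullet> (M *v y) + y \<bullet> (M *v x) + qform M y"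
  by (simp add: qform_def algebra_simps inner_add_left inner_add_right)

lemma qform_diff: "qform M (x - y) = qform M x - x \<bullet> (M *v y) - y \<bullet> (M *v x) + qform M y"
  by (simp add: qform_def algebra_simps inner_diff_left inner_diff_right)

lemma qform_scaleR: "qform M (c *\<^sub>R x) = c\<^sup>2 * qform M x"
  by (simp add: qform_def matrix_vector_mult_scaleR power2_eq_square)

lemma qform_matrix_add: "qform (M + N) x = qform M x + qform N x"
  by (simp add: qform_def matrix_vector_mult_add_rdistrib inner_add_right)

lemma qform_matrix_diff: "qform (M - N) x = qform M x - qform N x"
  by (simp add: qform_def matrix_vector_mult_diff_rdistrib inner_diff_right)

lemma qform_polarization:
  "symmetric_mat P \<Longrightarrow> 4 * (x \<bullet> (P *v y)) = qform P (x + y) - qform P (x - y)"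
  using qform_add[of P x y] qform_diff[of P x y] symmetric_inner_swap[of P x y] by simp

lemma qform_parallelogram: "qform P (x + y) + qform P (x - y) = 2 * qform P x + 2 * qform P y"
  using qform_add[of P x y] qform_diff[of P x y] by simp

lemma symmetric_mat_eqI:
  assumes "symmetric_mat M" "symmetric_mat N" "\<And>x. qform M x = qform N x"
  shows "M = N"
proof -
  have "x \<bullet> (M *v y) = x \<bullet> (N *v y)" for x y
    using qform_polarization[OF assms(1), of x y] qform_polarization[OF assms(2), of x y] assms(3)
    by simp
  then show ?thesis
    by (simp add: vec_eq_iff matrix_entry_inner_axis)
qed

lemma qform_le_onorm: "qform M x \<le> onorm ((*v) M) * (x \<bullet> x)"
proof -
  have "qform M x \<le> norm x * norm (M *v x)"
    unfolding qform_def by (rule norm_cauchy_schwarz)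
  also have "\<dots> \<le> norm x * (onorm ((*v) M) * norm x)"
    by (intro mult_left_mono onorm matrix_vector_mul_bounded_linear) auto
  finally show ?thesis
    by (simp add: power2_norm_eq_inner[symmetric] power2_eq_square mult_ac)
qed

text \<open>A Cauchy-Schwarz inequality for positive semidefinite forms, in the weighted form
  that avoids square roots.\<close>

lemma qform_add_le:
  assumes "psd_mat P" "0 < t"
  shows "qform P (x + y) \<le> (1 + 1 / t) * qform P x + (1 + t) * qform P y"
proof -
  have "0 \<le> qform P (x - t *\<^sub>R y)"
    using assms(1) by (simp add: psd_mat_def)
  then have "2 * t * (x \<bullet> (P *v y)) \<le> qform P x + t\<^sup>2 * qform P y"
    using assms(1) symmetric_inner_swap[of P x y]
    by (simp add: psd_mat_def qform_diff qform_scaleR matrix_vector_mult_scaleR)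
  then have "2 * (x \<bullet> (P *v y)) \<le> qform P x / t + t * qform P y"
    using assms(2) by (simp add: field_simps power2_eq_square)
  moreover have "qform P (x + y) = qform P x + 2 * (x \<bullet> (P *v y)) + qform P y"
    using qform_add[of P x y] symmetric_inner_swap[of P x y] assms(1) by (simp add: psd_mat_def)
  moreover have "(1 + 1 / t) * qform P x + (1 + t) * qform P y
      = qform P x + qform P x / t + qform P y + t * qform P y"
    by (simp add: algebra_simps)
  ultimately show ?thesis
    by linarith
qed

lemma invertible_if_kernel_trivial:
  "(\<And>z. (M::real^'n^'n) *v z = 0 \<Longrightarrow> z = 0) \<Longrightarrow> invertible M"
  using invertible_left_inverse matrix_left_invertible_ker by blast

lemma invertible_if_lower_bound:
  assumes "\<And>z. norm z \<le> L * norm ((M::real^'n^'n) *v z)"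
  shows "invertible M"
  using assms by (intro invertible_if_kernel_trivial) (metis mult_zero_right norm_le_zero_iff norm_zero)

lemma matrix_inv_mult:
  assumes "invertible M"
  shows "M ** matrix_inv M = mat 1" "matrix_inv M ** M = mat 1"
  using someI_ex[OF assms[unfolded invertible_def]] by (auto simp: matrix_inv_def)

lemma matrix_vector_mult_matrix_inv:
  "invertible M \<Longrightarrow> M *v (matrix_inv M *v x) = x"
  by (simp add: matrix_inv_mult matrix_vector_mul_assoc)

lemma symmetric_matrix_inv:
  assumes "symmetric_mat (S::real^'n^'n)" "invertible S"
  shows "symmetric_mat (matrix_inv S)"
proof -
  have "transpose (matrix_inv S) ** S = transpose (S ** matrix_inv S)"
    using assms(1) by (simp add: matrix_transpose_mul symmetric_mat_def)
  also have "\<dots> = mat 1"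
    using assms(2) by (simp add: matrix_inv_mult)
  finally have left_inv: "transpose (matrix_inv S) ** S = mat 1" .
  have "transpose (matrix_inv S) = transpose (matrix_inv S) ** (S ** matrix_inv S)"
    using assms(2) by (simp add: matrix_inv_mult)
  also have "\<dots> = matrix_inv S"
    by (simp add: matrix_mul_assoc left_inv)
  finally show ?thesis
    by (simp add: symmetric_mat_def)
qed

lemma norm_matrix_inv_le:
  assumes "\<And>z. norm z \<le> L * norm ((M::real^'n^'n) *v z)"
  shows "norm (matrix_inv M *v y) \<le> L * norm y"
  using assms[of "matrix_inv M *v y"] invertible_if_lower_bound[OF assms]
  by (simp add: matrix_vector_mult_matrix_inv)

text \<open>Duality: a lower bound for \<open>N\<close> transfers to \<open>transpose N\<close>, since
  \<open>\<parallel>z\<parallel>\<^sup>2 = (transpose N *v z) \<bullet> w\<close> for \<open>N *v w = z\<close>.\<close>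

lemma norm_le_transpose_if_norm_le:
  assumes "\<And>z. norm z \<le> L * norm ((N::real^'n^'n) *v z)"
  shows "norm z \<le> L * norm (transpose N *v z)"
proof (cases "z = 0")
  case False
  define w where "w = matrix_inv N *v z"
  have Nw: "N *v w = z"
    using invertible_if_lower_bound[OF assms] by (simp add: w_def matrix_vector_mult_matrix_inv)
  have "norm z ^ 2 = (transpose N *v z) \<bullet> w"
    by (simp add: Nw power2_norm_eq_inner inner_matrix_vector_transpose[symmetric])
  also have "\<dots> \<le> norm (transpose N *v z) * norm w"
    by (rule norm_cauchy_schwarz)
  also have "\<dots> \<le> norm (transpose N *v z) * (L * norm z)"
    using assms[of w] by (intro mult_left_mono) (auto simp: Nw)
  finally show ?thesis
    using False by (simp add: power2_eq_square mult_ac)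
qed simp

lemma norm_le_if_qform_ge:
  assumes "0 < a" "a * (z \<bullet> z) \<le> qform P z"
  shows "norm z \<le> 1 / a * norm (P *v z)"
proof (cases "z = 0")
  case False
  have "a * norm z ^ 2 \<le> norm z * norm (P *v z)"
    using assms(2) norm_cauchy_schwarz[of z "P *v z"]
    by (simp add: qform_def power2_norm_eq_inner)
  then show ?thesis
    using assms(1) False by (simp add: field_simps power2_eq_square)
qed simp

section \<open>The Riccati operator\<close>

definition control_hessian :: "real^'m^'n \<Rightarrow> real^'m^'m \<Rightarrow> real^'n^'n \<Rightarrow> real^'m^'m" where
  "control_hessian B R P = transpose B ** P ** B + R"

definition riccati ::
  "real^'n^'n \<Rightarrow> real^'m^'n \<Rightarrow> real^'n^'n \<Rightarrow> real^'m^'m \<Rightarrow> real^'n^'n \<Rightarrow> real^'n^'n" where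
  "riccati A B Q R P = Q + transpose A **
     (P - P ** B ** matrix_inv (transpose B ** P ** B + R) ** transpose B ** P) ** A"

definition riccati_gain :: "real^'n^'n \<Rightarrow> real^'m^'n \<Rightarrow> real^'m^'m \<Rightarrow> real^'n^'n \<Rightarrow> real^'n^'m" where
  "riccati_gain A B R P = matrix_inv (control_hessian B R P) ** transpose B ** P ** A"

definition lq_cost ::
  "real^'n^'n \<Rightarrow> real^'m^'n \<Rightarrow> real^'n^'n \<Rightarrow> real^'m^'m \<Rightarrow> real^'n^'n \<Rightarrow> real^'n \<Rightarrow> real^'m \<Rightarrow> real"
  where "lq_cost A B Q R P x u = qform Q x + qform R u + qform P (A *v x + B *v u)"

text \<open>The form of \<open>riccati A B Q R P\<close> at \<open>x\<close> is the minimum of \<open>lq_cost A B Q R P x\<close>, attained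
  at \<open>u = - (riccati_gain A B R P *v x)\<close>.\<close>

lemma is_DARE_sol_iff: "is_DARE_sol A B Q R P \<longleftrightarrow> P = riccati A B Q R P"
  by (simp add: is_DARE_sol_def riccati_def)

lemma pos_def_qform: "pos_def M \<Longrightarrow> x \<noteq> 0 \<Longrightarrow> 0 < qform M x"
  by (simp add: pos_def_def qform_def)

lemma psd_if_pos_def: "pos_def M \<Longrightarrow> psd_mat M"
  unfolding psd_mat_def by (metis pos_def_def pos_def_qform qform_0 order.refl less_imp_le)

lemma qform_control_hessian: "qform (control_hessian B R P) u = qform P (B *v u) + qform R u"
proof -
  have "qform (transpose B ** P ** B) u = qform P (B *v u)"
    by (simp add: qform_def matrix_vector_mul_assoc[symmetric]
        inner_matrix_vector_transpose[of u "transpose B"])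
  then show ?thesis
    by (simp add: control_hessian_def qform_matrix_add)
qed

lemma symmetric_control_hessian:
  "symmetric_mat P \<Longrightarrow> symmetric_mat R \<Longrightarrow> symmetric_mat (control_hessian B R P)"
  by (simp add: symmetric_mat_def control_hessian_def transpose_add matrix_transpose_mul
      matrix_mul_assoc)

lemma invertible_control_hessian:
  assumes "psd_mat P" "pos_def R"
  shows "invertible (control_hessian B R P)"
proof -
  have "u = 0" if "control_hessian B R P *v u = 0" for u
  proof (rule ccontr)
    assume "u \<noteq> 0"
    then have "0 < qform (control_hessian B R P) u"
      using assms pos_def_qform[of R u] by (simp add: qform_control_hessian psd_mat_def add_nonneg_pos)
    then show False
      using that by (simp add: qform_def)
  qed
  then show ?thesis
    by (rule invertible_if_kernel_trivial)
qed

lemma lq_cost_complete_square: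
  assumes P: "psd_mat P" and R: "pos_def R"
  shows "lq_cost A B Q R P x u
    = qform (riccati A B Q R P) x + qform (control_hessian B R P) (u + riccati_gain A B R P *v x)"
proof -
  let ?S = "control_hessian B R P"
  have sP: "symmetric_mat P" and sS: "symmetric_mat ?S"
    using assms symmetric_control_hessian[of P R B] by (auto simp: psd_mat_def pos_def_def)
  define w where "w = transpose B *v (P *v (A *v x))"
  define v where "v = matrix_inv ?S *v w"
  have Kx: "riccati_gain A B R P *v x = v"
    by (simp add: riccati_gain_def v_def w_def matrix_vector_mul_assoc[symmetric])
  have Sv: "?S *v v = w"
    using invertible_control_hessian[OF assms] by (simp add: v_def matrix_vector_mult_matrix_inv)
  have cross: "(A *v x) \<bullet> (P *v (B *v y)) = y \<bullet> w" for y
  proof -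
    have "(A *v x) \<bullet> (P *v (B *v y)) = (P *v (A *v x)) \<bullet> (B *v y)"
      using symmetric_inner_swap[OF sP] by (simp add: inner_commute)
    also have "\<dots> = w \<bullet> y"
      unfolding w_def by (rule inner_matrix_vector_transpose)
    finally show ?thesis
      by (simp add: inner_commute)
  qed
  have ric: "qform (riccati A B Q R P) x = qform Q x + qform P (A *v x) - w \<bullet> v"
  proof -
    have "qform (riccati A B Q R P) x
        = qform Q x + (A *v x) \<bullet> (P *v (A *v x)) - (A *v x) \<bullet> (P *v (B *v v))"
      unfolding riccati_def qform_def v_def w_def control_hessian_def
      by (simp add: matrix_vector_mul_assoc[symmetric] matrix_vector_mult_add_rdistrib
          matrix_vector_mult_diff_rdistrib inner_add_right inner_diff_right
          inner_matrix_vector_transpose[of x "transpose A"])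
    then show ?thesis
      by (simp add: qform_def cross inner_commute)
  qed
  have hess: "qform ?S (u + v) = qform ?S u + 2 * (u \<bullet> w) + v \<bullet> w"
    using qform_add[of ?S u v] symmetric_inner_swap[OF sS, of u v] Sv
    by (simp add: qform_def inner_commute)
  have "lq_cost A B Q R P x u = qform Q x + qform R u + qform P (A *v x) + 2 * (u \<bullet> w)
      + qform P (B *v u)"
    unfolding lq_cost_def using cross symmetric_inner_swap[OF sP, of "A *v x" "B *v u"]
    by (simp add: qform_add)
  then show ?thesis
    using ric hess Kx qform_control_hessian[of B R P u] by (simp add: qform_def inner_commute)
qed

lemma riccati_le_lq_cost:
  assumes "psd_mat P" "pos_def R"
  shows "qform (riccati A B Q R P) x \<le> lq_cost A B Q R P x u"
proof -
  have "0 \<le> qform (control_hessian B R P) v" for v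
    using assms psd_if_pos_def[of R] by (simp add: qform_control_hessian psd_mat_def)
  then show ?thesis
    using lq_cost_complete_square[OF assms, of A B Q x u] by simp
qed

lemma riccati_eq_lq_cost_gain:
  "psd_mat P \<Longrightarrow> pos_def R \<Longrightarrow>
    qform (riccati A B Q R P) x = lq_cost A B Q R P x (- (riccati_gain A B R P *v x))"
  using lq_cost_complete_square[of P R A B Q x "- (riccati_gain A B R P *v x)"] by simp

lemma closed_loop_mult:
  "(A::real^'n^'n) *v x + (B::real^'m^'n) *v (- (K *v x)) = (A - B ** K) *v x"
  by (simp add: matrix_vector_mult_uminus_right matrix_vector_mult_diff_rdistrib
      matrix_vector_mul_assoc[symmetric])

lemma riccati_ge_closed_loop:
  assumes "psd_mat P" "pos_def R"
  shows "qform Q x + qform P ((A - B ** riccati_gain A B R P) *v x) \<le> qform (riccati A B Q R P) x"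
  using riccati_eq_lq_cost_gain[OF assms, of A B Q x] psd_if_pos_def[OF assms(2)]
  by (simp add: lq_cost_def closed_loop_mult psd_mat_def)

lemma riccati_mono:
  assumes "psd_mat P" "psd_mat P'" "pos_def R" "\<And>y. qform P y \<le> qform P' y"
  shows "qform (riccati A B Q R P) x \<le> qform (riccati A B Q R P') x"
proof -
  let ?u = "- (riccati_gain A B R P' *v x)"
  have "qform (riccati A B Q R P) x \<le> lq_cost A B Q R P x ?u"
    using assms(1,3) by (rule riccati_le_lq_cost)
  also have "\<dots> \<le> lq_cost A B Q R P' x ?u"
    using assms(4) by (simp add: lq_cost_def)
  also have "\<dots> = qform (riccati A B Q R P') x"
    using riccati_eq_lq_cost_gain[OF assms(2,3)] by simp
  finally show ?thesis .
qed

lemma symmetric_riccati: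
  assumes "psd_mat P" "pos_def R" "symmetric_mat Q"
  shows "symmetric_mat (riccati A B Q R P)"
proof -
  have sP: "transpose P = P" and sR: "symmetric_mat R"
    using assms by (auto simp: psd_mat_def pos_def_def symmetric_mat_def)
  have "transpose (matrix_inv (control_hessian B R P)) = matrix_inv (control_hessian B R P)"
    using symmetric_matrix_inv[OF symmetric_control_hessian invertible_control_hessian] assms sR
    by (auto simp: psd_mat_def symmetric_mat_def)
  then show ?thesis
    using assms(3) sP
    unfolding symmetric_mat_def riccati_def control_hessian_def[symmetric]
    by (simp add: transpose_add transpose_diff matrix_transpose_mul matrix_mul_assoc)
qed

lemma psd_riccati:
  assumes "psd_mat P" "pos_def R" "psd_mat Q"
  shows "psd_mat (riccati A B Q R P)"
  using symmetric_riccati[OF assms(1,2)] riccati_ge_closed_loop[OF assms(1,2)] assms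
  by (smt (verit) psd_mat_def)

lemma loewner_box_symmetric: "Q \<in> loewner_box a b \<Longrightarrow> symmetric_mat Q"
  by (simp add: loewner_box_def)

lemma loewner_box_lower: "Q \<in> loewner_box a b \<Longrightarrow> a * (x \<bullet> x) \<le> qform Q x"
  by (simp add: loewner_box_def qform_def)

lemma loewner_box_upper: "Q \<in> loewner_box a b \<Longrightarrow> qform Q x \<le> b * (x \<bullet> x)"
  by (simp add: loewner_box_def qform_def)

lemma loewner_box_pos_def: "Q \<in> loewner_box a b \<Longrightarrow> 0 < a \<Longrightarrow> pos_def Q"
  unfolding pos_def_def
  using loewner_box_lower[of Q a b] loewner_box_symmetric[of Q a b]
  by (smt (verit) inner_gt_zero_iff mult_pos_pos qform_def)

section \<open>Consequences of controllability\<close>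

lemma matpow_Suc_right: "matpow A (Suc k) = matpow A k ** A"
  by (induction k) (simp_all add: matrix_mul_assoc)

lemma column_eq_matrix_vector_axis: "column j M = (M::real^'a^'b) *v axis j 1"
  by (simp add: column_def matrix_vector_mult_def axis_def vec_eq_iff if_distrib cong: if_cong)

lemma controllable_backward_closed_subspace:
  fixes A :: "real^'n^'n" and B :: "real^'m^'n"
  assumes ctrl: "controllable A B" and S: "subspace S"
    and closed: "\<And>x u. A *v x + B *v u \<in> S \<Longrightarrow> x \<in> S"
  shows "x \<in> S"
proof -
  define C where "C k = (\<Union>i\<in>{..<k}. range (\<lambda>j. column j (matpow A i ** B)))" for k
  have "\<forall>x. matpow A k *v x \<in> span (C k) \<longrightarrow> x \<in> S" for k
  proof (induction k)
    case 0
    then show ?case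
      using S by (simp add: C_def subspace_0)
  next
    case (Suc k)
    show ?case
    proof (intro allI impI)
      fix x assume "matpow A (Suc k) *v x \<in> span (C (Suc k))"
      moreover have "C (Suc k) = C k \<union> range (\<lambda>j. column j (matpow A k ** B))"
        by (auto simp: C_def lessThan_Suc)
      ultimately obtain s t where st: "matpow A (Suc k) *v x = s + t" "s \<in> span (C k)"
          "t \<in> span (range (\<lambda>j. column j (matpow A k ** B)))"
        by (auto simp: span_Un)
      have "span (range (\<lambda>j. column j (matpow A k ** B))) \<subseteq> range ((*v) (matpow A k ** B))"
        by (rule span_minimal)
          (auto simp: column_eq_matrix_vector_axis
            intro: linear_subspace_image[OF matrix_vector_mul_linear subspace_UNIV])
      then obtain w where w: "t = (matpow A k ** B) *v w"
        using st(3) by blast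
      have "matpow A k *v (A *v x + B *v (- w)) = s"
        using st(1) w
        by (simp only: matpow_Suc_right matrix_vector_mul_assoc[symmetric]
            matrix_vector_right_distrib matrix_vector_mult_uminus_right) simp
      then show "x \<in> S"
        using Suc.IH st(2) closed by metis
    qed
  qed
  moreover have "span (C CARD('n)) = UNIV"
    using ctrl by (simp add: controllable_def C_def)
  ultimately show ?thesis
    by blast
qed

lemma subspace_qform_bounded:
  assumes "\<And>P x. P \<in> F \<Longrightarrow> 0 \<le> qform P x"
  shows "subspace {x. \<exists>c. \<forall>P\<in>F. qform P x \<le> c}"
  unfolding subspace_def
proof (intro conjI ballI allI)
  show "0 \<in> {x. \<exists>c. \<forall>P\<in>F. qform P x \<le> c}"
    by auto
next
  fix x y assume "x \<in> {x. \<exists>c. \<forall>P\<in>F. qform P x \<le> c}" "y \<in> {x. \<exists>c. \<forall>P\<in>F. qform P x \<le> c}"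
  then obtain c1 c2 where c1: "\<forall>P\<in>F. qform P x \<le> c1" and c2: "\<forall>P\<in>F. qform P y \<le> c2"
    by auto
  have "qform P (x + y) \<le> 2 * c1 + 2 * c2" if "P \<in> F" for P
    using qform_parallelogram[of P x y] assms[OF that, of "x - y"] c1 c2 that by force
  then show "x + y \<in> {x. \<exists>c. \<forall>P\<in>F. qform P x \<le> c}"
    by auto
next
  fix r :: real and x assume "x \<in> {x. \<exists>c. \<forall>P\<in>F. qform P x \<le> c}"
  then obtain c where "\<forall>P\<in>F. qform P x \<le> c"
    by auto
  then have "\<forall>P\<in>F. qform P (r *\<^sub>R x) \<le> r\<^sup>2 * c"
    by (simp add: qform_scaleR mult_left_mono)
  then show "r *\<^sub>R x \<in> {x. \<exists>c. \<forall>P\<in>F. qform P x \<le> c}"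
    by auto
qed

text \<open>The states at which the family is bounded form a subspace closed under stepping backwards.\<close>

lemma qform_bounded_if_controllable:
  fixes A :: "real^'n^'n" and B :: "real^'m^'n"
  assumes ctrl: "controllable A B"
    and nonneg: "\<And>P x. P \<in> F \<Longrightarrow> 0 \<le> qform P x"
    and step: "\<And>P. P \<in> F \<Longrightarrow>
      \<exists>P'\<in>F. \<forall>x u. qform P x \<le> a * (x \<bullet> x) + b * (u \<bullet> u) + qform P' (A *v x + B *v u)"
  shows "\<exists>c. \<forall>P\<in>F. qform P x \<le> c"
proof -
  have "y \<in> {x. \<exists>c. \<forall>P\<in>F. qform P x \<le> c}"
    if "A *v y + B *v u \<in> {x. \<exists>c. \<forall>P\<in>F. qform P x \<le> c}" for y u
  proof -
    from that obtain c where c: "\<forall>P\<in>F. qform P (A *v y + B *v u) \<le> c"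
      by blast
    have "qform P y \<le> a * (y \<bullet> y) + b * (u \<bullet> u) + c" if P: "P \<in> F" for P
    proof -
      obtain P' where "P' \<in> F"
        and "qform P y \<le> a * (y \<bullet> y) + b * (u \<bullet> u) + qform P' (A *v y + B *v u)"
        using step[OF P] by blast
      then show ?thesis
        using c by fastforce
    qed
    then show ?thesis
      by blast
  qed
  then show ?thesis
    using controllable_backward_closed_subspace[OF ctrl subspace_qform_bounded[OF nonneg]] by blast
qed

lemma onorm_bounded_if_qform_bounded:
  assumes psd: "\<And>P. P \<in> F \<Longrightarrow> psd_mat P"
    and bounded: "\<And>x. \<exists>c. \<forall>P\<in>F. qform P x \<le> c"
  shows "\<exists>C. \<forall>P\<in>(F::(real^'n^'n) set). onorm ((*v) P) \<le> C"
proof -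
  obtain c where c: "\<And>x P. P \<in> F \<Longrightarrow> qform P x \<le> c x"
    using bounded by metis
  define C where "C = (\<Sum>i\<in>(UNIV::'n set). \<Sum>j\<in>(UNIV::'n set).
      (c (axis i 1 + axis j 1) + c (axis i 1 - axis j 1)) / 4)"
  have "onorm ((*v) P) \<le> C" if P: "P \<in> F" for P
  proof -
    have "\<bar>P $ i $ j\<bar> \<le> (c (axis i 1 + axis j 1) + c (axis i 1 - axis j 1)) / 4" for i j
    proof -
      let ?x = "axis i (1::real)" and ?y = "axis j (1::real)"
      have "4 * P $ i $ j = qform P (?x + ?y) - qform P (?x - ?y)"
        using qform_polarization[of P ?x ?y] psd[OF P] by (simp add: psd_mat_def matrix_entry_inner_axis)
      moreover have "0 \<le> qform P (?x + ?y)" "0 \<le> qform P (?x - ?y)"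
        using psd[OF P] by (auto simp: psd_mat_def)
      moreover have "qform P (?x + ?y) \<le> c (?x + ?y)" "qform P (?x - ?y) \<le> c (?x - ?y)"
        using c[OF P] by auto
      ultimately show ?thesis
        by (auto simp: abs_le_iff)
    qed
    then have "(\<Sum>i\<in>UNIV. \<Sum>j\<in>UNIV. \<bar>P $ i $ j\<bar>) \<le> C"
      unfolding C_def by (intro sum_mono)
    then show ?thesis
      using onorm_le_matrix_component_sum[of P] by linarith
  qed
  then show ?thesis
    by blast
qed

section \<open>Existence and uniqueness of the positive definite solution\<close>

lemma riccati_le_box_cost:
  assumes "psd_mat P" "Q \<in> loewner_box a1 b1" "R \<in> loewner_box a2 b2" "0 < a2"
  shows "qform (riccati A B Q R P) x \<le> b1 * (x \<bullet> x) + b2 * (u \<bullet> u) + qform P (A *v x + B *v u)"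
  using riccati_le_lq_cost[OF assms(1) loewner_box_pos_def[OF assms(3,4)], of A B Q x u]
    loewner_box_upper[OF assms(2), of x] loewner_box_upper[OF assms(3), of u]
  by (simp add: lq_cost_def)

lemma riccati_ge_box_closed_loop:
  assumes "psd_mat P" "pos_def R" "Q \<in> loewner_box a b"
  shows "a * (x \<bullet> x) + qform P ((A - B ** riccati_gain A B R P) *v x) \<le> qform (riccati A B Q R P) x"
  using riccati_ge_closed_loop[OF assms(1,2), where A=A and B=B and Q=Q and x=x]
    loewner_box_lower[OF assms(3), of x]
  by linarith

lemma qform_contraction:
  assumes "\<And>x. a * (x \<bullet> x) + qform P (M *v x) \<le> qform P x" "\<And>x. qform P x \<le> c * (x \<bullet> x)"
    "0 \<le> a" "0 < c"
  shows "qform P (M *v x) \<le> (1 - a / c) * qform P x"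
proof -
  have "a / c * qform P x \<le> a / c * (c * (x \<bullet> x))"
    using assms(2-4) by (intro mult_left_mono) auto
  also have "\<dots> = a * (x \<bullet> x)"
    using assms(4) by simp
  finally show ?thesis
    using assms(1)[of x] by (simp add: algebra_simps)
qed

lemma qform_matpow_le:
  assumes "\<And>x. qform P (M *v x) \<le> r * qform P x" "0 \<le> r"
  shows "qform P (matpow M k *v x) \<le> r ^ k * qform P x"
proof (induction k)
  case (Suc k)
  have "qform P (matpow M (Suc k) *v x) \<le> r * qform P (matpow M k *v x)"
    using assms(1) by (simp add: matrix_vector_mul_assoc[symmetric])
  also have "\<dots> \<le> r * (r ^ k * qform P x)"
    using Suc assms(2) by (rule mult_left_mono)
  finally show ?case
    by (simp add: mult.assoc)
qed simp

lemma dare_solution_decrease: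
  assumes "psd_mat P" "P = riccati A B Q R P" "pos_def R" "Q \<in> loewner_box a b"
  shows "a * (x \<bullet> x) + qform P ((A - B ** riccati_gain A B R P) *v x) \<le> qform P x"
  using riccati_ge_box_closed_loop[OF assms(1,3,4)] assms(2) by metis

lemma dare_solution_lower:
  assumes "psd_mat P" "P = riccati A B Q R P" "pos_def R" "Q \<in> loewner_box a b"
  shows "a * (x \<bullet> x) \<le> qform P x"
  using dare_solution_decrease[OF assms, of x] assms(1) by (smt (verit) psd_mat_def)

lemma dare_solution_closed_loop_decay:
  assumes P: "psd_mat P" "P = riccati A B Q R P" and R: "pos_def R"
    and Q: "Q \<in> loewner_box a b" and a: "0 < a"
  obtains r where "0 \<le> r" "r < 1"
    "\<And>k y. qform P (matpow (A - B ** riccati_gain A B R P) k *v y) \<le> r ^ k * qform P y"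
proof -
  define c where "c = max (onorm ((*v) P)) a"
  have c: "0 < c" "a \<le> c"
    using a by (auto simp: c_def)
  have upper: "qform P y \<le> c * (y \<bullet> y)" for y
    using qform_le_onorm[of P y] mult_right_mono[of "onorm ((*v) P)" c "y \<bullet> y"]
    by (simp add: c_def)
  have "qform P ((A - B ** riccati_gain A B R P) *v y) \<le> (1 - a / c) * qform P y" for y
    using dare_solution_decrease[OF P R Q] upper less_imp_le[OF a] c(1) by (rule qform_contraction)
  moreover have "0 \<le> 1 - a / c" "1 - a / c < 1"
    using a c by auto
  ultimately show ?thesis
    using that qform_matpow_le by blast
qed

text \<open>Along the closed loop of \<open>P1\<close>, the excess of \<open>qform P2\<close> over \<open>qform P1\<close> can only
  grow, while \<open>qform P1\<close> decays geometrically; so the excess is never positive.\<close>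

lemma dare_solution_le:
  assumes P1: "psd_mat P1" "P1 = riccati A B Q R P1" and P2: "psd_mat P2" "P2 = riccati A B Q R P2"
    and Q: "Q \<in> loewner_box a b" and a: "0 < a" and R: "pos_def R"
  shows "qform P2 x \<le> qform P1 x"
proof -
  define M where "M = A - B ** riccati_gain A B R P1"
  define excess where "excess y = qform P2 y - qform P1 y" for y
  have step: "excess y \<le> excess (M *v y)" for y
  proof -
    have "qform P2 y \<le> lq_cost A B Q R P2 y (- (riccati_gain A B R P1 *v y))"
      using riccati_le_lq_cost[OF P2(1) R] P2(2) by metis
    moreover have "qform P1 y = lq_cost A B Q R P1 y (- (riccati_gain A B R P1 *v y))"
      using riccati_eq_lq_cost_gain[OF P1(1) R] P1(2) by metis
    ultimately show ?thesis
      by (simp add: excess_def lq_cost_def closed_loop_mult M_def)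
  qed
  have drift: "excess y \<le> excess (matpow M k *v y)" for k y
  proof (induction k arbitrary: y)
    case (Suc k)
    have "matpow M (Suc k) *v y = matpow M k *v (M *v y)"
      by (simp only: matpow_Suc_right matrix_vector_mul_assoc[symmetric])
    then show ?case
      using step[of y] Suc[of "M *v y"] by simp
  qed simp
  obtain r where r: "0 \<le> r" "r < 1" and decay: "\<And>k y. qform P1 (matpow M k *v y) \<le> r ^ k * qform P1 y"
    using dare_solution_closed_loop_decay[OF P1 R Q a] unfolding M_def by blast
  have geometric: "excess x \<le> (onorm ((*v) P2) / a * qform P1 x) * r ^ k" for k
  proof -
    let ?y = "matpow M k *v x"
    have "excess x \<le> qform P2 ?y"
      using drift[of x k] P1(1) unfolding excess_def psd_mat_def by (smt (verit))
    also have "\<dots> \<le> onorm ((*v) P2) * (?y \<bullet> ?y)"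
      by (rule qform_le_onorm)
    also have "\<dots> \<le> onorm ((*v) P2) * (qform P1 ?y / a)"
      using dare_solution_lower[OF P1 R Q, of ?y] a
      by (intro mult_left_mono onorm_pos_le) (auto simp: field_simps)
    also have "\<dots> \<le> onorm ((*v) P2) * (r ^ k * qform P1 x / a)"
      using decay[of k x] a by (intro mult_left_mono onorm_pos_le divide_right_mono) auto
    finally show ?thesis
      by (simp add: field_simps)
  qed
  have "(\<lambda>k. (onorm ((*v) P2) / a * qform P1 x) * r ^ k) \<longlonglongrightarrow> (onorm ((*v) P2) / a * qform P1 x) * 0"
    using r by (intro tendsto_mult tendsto_const LIMSEQ_power_zero) auto
  then have "excess x \<le> 0"
    using geometric by (intro LIMSEQ_le_const) auto
  then show ?thesis
    by (simp add: excess_def)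
qed

lemma dare_solution_unique:
  assumes "psd_mat P1" "P1 = riccati A B Q R P1" "psd_mat P2" "P2 = riccati A B Q R P2"
    and "Q \<in> loewner_box a b" "0 < a" "pos_def R"
  shows "P1 = P2"
  using dare_solution_le[OF assms(1-4)] dare_solution_le[OF assms(3,4,1,2)] assms
  by (intro symmetric_mat_eqI) (auto simp: psd_mat_def intro: order.antisym)

lemma psd_mat_0: "psd_mat 0"
  by (simp add: psd_mat_def symmetric_mat_def transpose_def vec_eq_iff qform_def)

lemma riccati_iterate_psd:
  assumes "psd_mat Q" "pos_def R"
  shows "psd_mat ((riccati A B Q R ^^ k) 0)"
  by (induction k) (simp_all add: psd_mat_0 psd_riccati assms)

lemma riccati_iterate_mono:
  assumes "psd_mat Q" "pos_def R"
  shows "qform ((riccati A B Q R ^^ k) 0) x \<le> qform ((riccati A B Q R ^^ Suc k) 0) x"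
proof (induction k arbitrary: x)
  case 0
  show ?case
    using riccati_iterate_psd[OF assms, of 1] by (simp add: psd_mat_def qform_def)
next
  case (Suc k)
  show ?case
    using riccati_mono[OF riccati_iterate_psd[OF assms] riccati_iterate_psd[OF assms] assms(2) Suc]
    by simp
qed

lemma qform_sum: "qform M x = (\<Sum>i\<in>UNIV. \<Sum>j\<in>UNIV. x $ i * M $ i $ j * x $ j)"
  by (simp add: qform_def inner_vec_def matrix_vector_mult_def sum_distrib_left mult.assoc)

lemma tendsto_qform: "P \<longlonglongrightarrow> L \<Longrightarrow> (\<lambda>k. qform (P k) x) \<longlonglongrightarrow> qform L x"
  unfolding qform_sum by (intro tendsto_intros)

lemma tendsto_onorm_diff:
  fixes P :: "nat \<Rightarrow> real^'n^'m"
  assumes "P \<longlonglongrightarrow> L"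
  shows "(\<lambda>k. onorm ((*v) (L - P k))) \<longlonglongrightarrow> 0"
proof -
  have "(\<lambda>k. P k $ i $ j) \<longlonglongrightarrow> L $ i $ j" for i j
    using assms by (intro tendsto_vec_nth)
  then have "(\<lambda>k. L $ i $ j - P k $ i $ j) \<longlonglongrightarrow> L $ i $ j - L $ i $ j" for i j
    by (intro tendsto_diff tendsto_const)
  then have "(\<lambda>k. \<bar>(L - P k) $ i $ j\<bar>) \<longlonglongrightarrow> 0" for i j
    by (intro tendsto_rabs_zero) simp
  then have sum0: "(\<lambda>k. \<Sum>i\<in>UNIV. \<Sum>j\<in>UNIV. \<bar>(L - P k) $ i $ j\<bar>) \<longlonglongrightarrow> 0"
    by (intro tendsto_null_sum)
  have "\<forall>\<^sub>F k in sequentially. 0 \<le> onorm ((*v) (L - P k))"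
    by (intro always_eventually allI onorm_pos_le matrix_vector_mul_bounded_linear)
  moreover have "\<forall>\<^sub>F k in sequentially.
      onorm ((*v) (L - P k)) \<le> (\<Sum>i\<in>UNIV. \<Sum>j\<in>UNIV. \<bar>(L - P k) $ i $ j\<bar>)"
    by (intro always_eventually allI onorm_le_matrix_component_sum)
  ultimately show ?thesis
    by (rule tendsto_sandwich[OF _ _ tendsto_const sum0])
qed

lemma monotone_qform_limit:
  fixes P :: "nat \<Rightarrow> real^'n^'n"
  assumes sym: "\<And>k. symmetric_mat (P k)"
    and mono: "\<And>k x. qform (P k) x \<le> qform (P (Suc k)) x"
    and bounded: "\<And>x. \<exists>c. \<forall>k. qform (P k) x \<le> c"
  obtains L where "P \<longlonglongrightarrow> L" "symmetric_mat L" "\<And>k x. qform (P k) x \<le> qform L x"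
proof -
  have "\<exists>l. (\<lambda>k. qform (P k) x) \<longlonglongrightarrow> l" for x
  proof -
    obtain c where "\<forall>k. qform (P k) x \<le> c"
      using bounded by blast
    then show ?thesis
      using incseq_convergent[of "\<lambda>k. qform (P k) x" c] mono by (metis incseq_SucI)
  qed
  then obtain l where l: "\<And>x. (\<lambda>k. qform (P k) x) \<longlonglongrightarrow> l x"
    by metis
  have l_uminus: "l (- v) = l v" for v
    using l[of "- v"] l[of v] by (simp add: LIMSEQ_unique)
  define L where "L = (\<chi> i j. (l (axis i 1 + axis j 1) - l (axis i 1 - axis j 1)) / 4)"
  have "(\<lambda>k. P k $ i $ j) \<longlonglongrightarrow> L $ i $ j" for i j
  proof -
    have "P k $ i $ j = (qform (P k) (axis i 1 + axis j 1) - qform (P k) (axis i 1 - axis j 1)) / 4"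
      for k
      using qform_polarization[OF sym[of k], of "axis i 1" "axis j 1"] by (simp add: matrix_entry_inner_axis)
    then have "(\<lambda>k. P k $ i $ j)
        = (\<lambda>k. (qform (P k) (axis i 1 + axis j 1) - qform (P k) (axis i 1 - axis j 1)) / 4)"
      by (rule ext)
    then show ?thesis
      unfolding L_def vec_lambda_beta by (simp only:) (auto intro!: tendsto_intros l)
  qed
  then have PL: "P \<longlonglongrightarrow> L"
    by (intro vec_tendstoI)
  moreover have "symmetric_mat L"
    using l_uminus[of "axis i 1 - axis j 1" for i j]
    by (simp add: symmetric_mat_def L_def transpose_def vec_eq_iff add.commute)
  moreover have "qform (P k) x \<le> qform L x" for k x
    using mono by (intro incseq_le[OF _ tendsto_qform[OF PL]]) (simp add: incseq_SucI)
  ultimately show ?thesis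
    using that by blast
qed

lemma norm_successor_le_of_lq_cost:
  assumes "psd_mat P" "psd_mat Q" "R \<in> loewner_box a b" "0 < a" "lq_cost A B Q R P x u \<le> v"
  shows "norm (A *v x + B *v u) \<le> onorm ((*v) A) * norm x + onorm ((*v) B) * sqrt (v / a)"
proof -
  have "a * (u \<bullet> u) \<le> qform R u"
    using assms(3) by (rule loewner_box_lower)
  also have "\<dots> \<le> v"
    using assms(1,2,5) by (simp add: lq_cost_def psd_mat_def) (smt (verit))
  finally have "norm u ^ 2 \<le> v / a"
    using assms(4) by (simp add: power2_norm_eq_inner field_simps mult.commute)
  then have "onorm ((*v) B) * norm u \<le> onorm ((*v) B) * sqrt (v / a)"
    by (intro mult_left_mono onorm_pos_le matrix_vector_mul_bounded_linear real_le_rsqrt)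
  moreover have "norm (A *v x + B *v u) \<le> norm (A *v x) + norm (B *v u)"
    by (rule norm_triangle_ineq)
  moreover have "\<dots> \<le> onorm ((*v) A) * norm x + onorm ((*v) B) * norm u"
    by (intro add_mono onorm matrix_vector_mul_bounded_linear)
  ultimately show ?thesis
    by linarith
qed

text \<open>The input that is optimal for \<open>P k\<close> is nearly optimal for the limit \<open>L\<close>: the states it
  leads to stay bounded, and \<open>P k\<close> converges to \<open>L\<close> in operator norm.\<close>

lemma riccati_limit_fixed_point:
  assumes psd: "\<And>k. psd_mat (P k)" and iter: "\<And>k. P (Suc k) = riccati A B Q R (P k)"
    and lim: "P \<longlonglongrightarrow> L" and below: "\<And>k x. qform (P k) x \<le> qform L x" and L: "psd_mat L"
    and Q: "psd_mat Q" and R: "R \<in> loewner_box a b" "0 < a"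
  shows "L = riccati A B Q R L"
proof -
  have R': "pos_def R"
    using R by (rule loewner_box_pos_def)
  have ge: "qform L x \<le> qform (riccati A B Q R L) x" for x
  proof -
    have "qform (P (Suc k)) x \<le> qform (riccati A B Q R L) x" for k
      unfolding iter using riccati_mono[OF psd L R'] below by blast
    then show ?thesis
      using LIMSEQ_le_const2[OF LIMSEQ_Suc[OF tendsto_qform[OF lim]]] by blast
  qed
  have le: "qform (riccati A B Q R L) x \<le> qform L x" for x
  proof -
    define u where "u k = - (riccati_gain A B R (P k) *v x)" for k
    define Z where "Z = onorm ((*v) A) * norm x + onorm ((*v) B) * sqrt (qform L x / a)"
    have cost: "lq_cost A B Q R (P k) x (u k) = qform (P (Suc k)) x" for k
      using riccati_eq_lq_cost_gain[OF psd R'] by (simp add: iter u_def)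
    have "(A *v x + B *v u k) \<bullet> (A *v x + B *v u k) \<le> Z\<^sup>2" for k
      using norm_successor_le_of_lq_cost[OF psd[of k] Q R, where A=A and B=B and x=x and u="u k" and v="qform L x"] cost below
      by (simp add: power2_norm_eq_inner[symmetric] Z_def power_mono)
    then have gap: "qform (L - P k) (A *v x + B *v u k) \<le> onorm ((*v) (L - P k)) * Z\<^sup>2" for k
      using qform_le_onorm[of "L - P k"] mult_left_mono[of _ _ "onorm ((*v) (L - P k))"]
        onorm_pos_le[of "(*v) (L - P k)"]
      by (meson matrix_vector_mul_bounded_linear order.trans)
    have "qform (riccati A B Q R L) x \<le> qform (P (Suc k)) x + onorm ((*v) (L - P k)) * Z\<^sup>2"
      for k
      using riccati_le_lq_cost[OF L R', of A B Q x "u k"] cost[of k] gap[of k]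
      by (simp add: lq_cost_def qform_matrix_diff)
    moreover have "(\<lambda>k. qform (P (Suc k)) x + onorm ((*v) (L - P k)) * Z\<^sup>2)
        \<longlonglongrightarrow> qform L x + 0 * Z\<^sup>2"
      by (intro tendsto_intros LIMSEQ_Suc tendsto_qform tendsto_onorm_diff lim)
    ultimately show ?thesis
      by (intro LIMSEQ_le_const) auto
  qed
  show ?thesis
    using ge le L symmetric_riccati[OF L R'] Q
    by (intro symmetric_mat_eqI) (auto simp: psd_mat_def intro: order.antisym)
qed

lemma riccati_iterates_bounded:
  fixes A :: "real^'n^'n" and B :: "real^'m^'n"
  assumes ctrl: "controllable A B" and Q: "Q \<in> loewner_box a1 b1" and R: "R \<in> loewner_box a2 b2"
    and a: "0 < a1" "0 < a2"
  shows "\<exists>c. \<forall>k. qform ((riccati A B Q R ^^ k) 0) x \<le> c"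
proof -
  define P where "P k = (riccati A B Q R ^^ k) 0" for k
  have psd: "psd_mat (P k)" for k
    unfolding P_def using loewner_box_pos_def Q R a psd_if_pos_def by (metis riccati_iterate_psd)
  have iter: "P (Suc k) = riccati A B Q R (P k)" for k
    by (simp add: P_def)
  have step: "\<exists>P'\<in>range P. \<forall>x u. qform (P k) x \<le> b1 * (x \<bullet> x) + b2 * (u \<bullet> u) + qform P' (A *v x + B *v u)"
    for k
  proof (cases k)
    case 0
    txt \<open>\<open>P 0 = 0\<close> has no predecessor; it is dominated by \<open>P 0\<close> itself, because the bound for
      \<open>P 1 \<ge> 0\<close> shows \<open>b1 * (x \<bullet> x) + b2 * (u \<bullet> u) \<ge> 0\<close>.\<close>
    have "qform (P 0) x \<le> b1 * (x \<bullet> x) + b2 * (u \<bullet> u) + qform (P 0) (A *v x + B *v u)" for x u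
    proof -
      have "qform (P 1) x \<le> b1 * (x \<bullet> x) + b2 * (u \<bullet> u) + qform (P 0) (A *v x + B *v u)"
        using riccati_le_box_cost[OF psd[of 0] Q R a(2), of A B x u] by (simp add: iter)
      moreover have "0 \<le> qform (P 1) x"
        using psd[of 1] by (simp add: psd_mat_def)
      ultimately show ?thesis
        by (simp add: P_def qform_def)
    qed
    then show ?thesis
      using 0 by blast
  next
    case (Suc j)
    have "\<forall>x u. qform (P k) x \<le> b1 * (x \<bullet> x) + b2 * (u \<bullet> u) + qform (P j) (A *v x + B *v u)"
      using riccati_le_box_cost[OF psd[of j] Q R a(2), where A=A and B=B] by (simp add: Suc iter)
    then show ?thesis
      by blast
  qed
  have "\<exists>c. \<forall>P'\<in>range P. qform P' x \<le> c"
    using ctrl by (rule qform_bounded_if_controllable) (use psd step in \<open>auto simp: psd_mat_def\<close>)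
  then show ?thesis
    by (simp add: P_def)
qed

lemma dare_solution_exists:
  fixes A :: "real^'n^'n" and B :: "real^'m^'n"
  assumes ctrl: "controllable A B" and Q: "Q \<in> loewner_box a1 b1" and R: "R \<in> loewner_box a2 b2"
    and a: "0 < a1" "0 < a2"
  shows "\<exists>P. pos_def P \<and> P = riccati A B Q R P"
proof -
  define P where "P k = (riccati A B Q R ^^ k) 0" for k
  have Q': "psd_mat Q" and R': "pos_def R"
    using loewner_box_pos_def Q R a psd_if_pos_def by blast+
  have psd: "psd_mat (P k)" for k
    unfolding P_def using Q' R' by (rule riccati_iterate_psd)
  have iter: "P (Suc k) = riccati A B Q R (P k)" for k
    by (simp add: P_def)
  have mono: "qform (P k) x \<le> qform (P (Suc k)) x" for k x
    unfolding P_def using Q' R' by (rule riccati_iterate_mono)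
  have sym: "symmetric_mat (P k)" for k
    using psd[of k] by (simp add: psd_mat_def)
  obtain L where lim: "P \<longlonglongrightarrow> L" and L: "symmetric_mat L" and below: "\<And>k x. qform (P k) x \<le> qform L x"
    using monotone_qform_limit[of P, OF sym mono] riccati_iterates_bounded[OF assms]
    unfolding P_def by blast
  have "a1 * (x \<bullet> x) \<le> qform L x" for x
    using riccati_ge_box_closed_loop[OF psd[of 0] R' Q, of x A B] below[of 1 x]
    by (simp add: iter P_def qform_def)
  then have "pos_def L"
    using L a(1) unfolding pos_def_def qform_def by (smt (verit) inner_gt_zero_iff mult_pos_pos)
  moreover have "L = riccati A B Q R L"
    using psd iter lim below psd_if_pos_def[OF \<open>pos_def L\<close>] Q' R a(2)
    by (rule riccati_limit_fixed_point)
  ultimately show ?thesis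
    by blast
qed

lemma Pe_DARE_solution:
  fixes A :: "real^'n^'n" and B :: "real^'m^'n"
  assumes "controllable A B" "Q \<in> loewner_box a1 b1" "R \<in> loewner_box a2 b2" "0 < a1" "0 < a2"
  shows "pos_def (Pe A B Q R)" "Pe A B Q R = riccati A B Q R (Pe A B Q R)"
proof -
  have "\<exists>!P. pos_def P \<and> is_DARE_sol A B Q R P"
    using dare_solution_exists[OF assms] dare_solution_unique[OF _ _ _ _ assms(2,4)]
      loewner_box_pos_def[OF assms(3,5)] psd_if_pos_def
    by (metis is_DARE_sol_iff)
  then have "pos_def (Pe A B Q R) \<and> is_DARE_sol A B Q R (Pe A B Q R)"
    unfolding Pe_def by (rule theI')
  then show "pos_def (Pe A B Q R)" "Pe A B Q R = riccati A B Q R (Pe A B Q R)"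
    by (simp_all add: is_DARE_sol_iff)
qed

section \<open>Uniform bounds\<close>

lemma Pe_onorm_bounded:
  fixes A :: "real^'n^'n" and B :: "real^'m^'n"
  assumes ctrl: "controllable A B" and a: "0 < a1" "0 < a2"
  shows "\<exists>C. \<forall>Q\<in>loewner_box a1 b1. \<forall>R\<in>loewner_box a2 b2. onorm ((*v) (Pe A B Q R)) \<le> C"
proof -
  define F where "F = {Pe A B Q R | Q R. Q \<in> loewner_box a1 b1 \<and> R \<in> loewner_box a2 b2}"
  have sol: "psd_mat P \<and> (\<forall>x u. qform P x \<le> b1 * (x \<bullet> x) + b2 * (u \<bullet> u) + qform P (A *v x + B *v u))"
    if "P \<in> F" for P
  proof -
    obtain Q R where Q: "Q \<in> loewner_box a1 b1" and R: "R \<in> loewner_box a2 b2" and P: "P = Pe A B Q R"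
      using \<open>P \<in> F\<close> by (auto simp: F_def)
    have "psd_mat P" "P = riccati A B Q R P"
      using Pe_DARE_solution[OF ctrl Q R a] psd_if_pos_def by (auto simp: P)
    then show ?thesis
      using riccati_le_box_cost[OF _ Q R a(2)] by metis
  qed
  have "\<exists>c. \<forall>P\<in>F. qform P x \<le> c" for x
    using ctrl
  proof (rule qform_bounded_if_controllable[where a=b1 and b=b2])
    show "0 \<le> qform P x" if "P \<in> F" for P x
      using sol[OF that] by (simp add: psd_mat_def)
    show "\<exists>P'\<in>F. \<forall>x u. qform P x \<le> b1 * (x \<bullet> x) + b2 * (u \<bullet> u) + qform P' (A *v x + B *v u)"
      if "P \<in> F" for P
      using sol[OF that] that by blast
  qed
  then obtain C where "\<forall>P\<in>F. onorm ((*v) P) \<le> C"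
    using onorm_bounded_if_qform_bounded[of F] sol by blast
  then show ?thesis
    by (auto simp: F_def)
qed

lemma loewner_box_onorm_bounded:
  assumes "0 < a"
  shows "\<exists>C. \<forall>Q\<in>(loewner_box a b :: (real^'n^'n) set). onorm ((*v) Q) \<le> C"
  using onorm_bounded_if_qform_bounded[of "loewner_box a b"] loewner_box_upper
    psd_if_pos_def loewner_box_pos_def[OF _ assms]
  by blast

text \<open>\<open>M\<close> contracts \<open>qform P\<close> by the factor \<open>1 - a / c\<close>; the weighted Cauchy-Schwarz
  inequality applied to \<open>z = (z - M z) + M z\<close> then bounds \<open>z\<close>.\<close>

lemma norm_le_closed_loop_defect:
  assumes P: "psd_mat P" and decrease: "\<And>x. a * (x \<bullet> x) + qform P (M *v x) \<le> qform P x"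
    and upper: "\<And>x. qform P x \<le> c * (x \<bullet> x)" and a: "0 < a" "a \<le> c"
  shows "norm z \<le> c / a * sqrt (2 * (1 + 2 * (c / a))) * norm ((mat 1 - M) *v z)"
proof -
  define s where "s = c / a"
  have s: "1 \<le> s"
    unfolding s_def using a by (subst le_divide_eq_1_pos) auto
  define x where "x = (mat 1 - M) *v z"
  have z: "z = x + M *v z"
    by (simp add: x_def matrix_vector_mult_diff_rdistrib)
  have nonneg: "0 \<le> qform P v" for v
    using P by (simp add: psd_mat_def)
  have "qform P (M *v z) \<le> (1 - a / c) * qform P z"
    using decrease upper less_imp_le[OF a(1)] by (rule qform_contraction) (use a in simp)
  then have contr: "qform P (M *v z) \<le> (1 - 1 / s) * qform P z"
    by (simp add: s_def)
  have "qform P z \<le> (1 + 2 * s) * qform P x + (1 + 1 / (2 * s)) * qform P (M *v z)"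
    using qform_add_le[OF P, of "1 / (2 * s)" x "M *v z"] s z by simp
  also have "(1 + 1 / (2 * s)) * qform P (M *v z) \<le> (1 + 1 / (2 * s)) * (1 - 1 / s) * qform P z"
    using contr s by (simp add: mult.assoc mult_left_mono)
  also have "\<dots> \<le> (1 - 1 / (2 * s)) * qform P z"
    using s nonneg[of z] by (intro mult_right_mono) (auto simp: field_simps)
  finally have "qform P z \<le> 2 * s * (1 + 2 * s) * qform P x"
    using s by (simp add: field_simps)
  also have "\<dots> \<le> 2 * s * (1 + 2 * s) * (c * (x \<bullet> x))"
    using s upper[of x] by (intro mult_left_mono) auto
  also have "\<dots> = a * (2 * s\<^sup>2 * (1 + 2 * s) * (x \<bullet> x))"
    using a(1) by (simp add: s_def power2_eq_square field_simps)
  finally have "a * (z \<bullet> z) \<le> a * (2 * s\<^sup>2 * (1 + 2 * s) * (x \<bullet> x))"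
    using decrease[of z] nonneg[of "M *v z"] by linarith
  then have "z \<bullet> z \<le> 2 * s\<^sup>2 * (1 + 2 * s) * (x \<bullet> x)"
    using a(1) by (rule mult_left_le_imp_le)
  then have "norm z ^ 2 \<le> 2 * s\<^sup>2 * (1 + 2 * s) * norm x ^ 2"
    by (simp only: power2_norm_eq_inner)
  also have "\<dots> = (s * sqrt (2 * (1 + 2 * s)) * norm x)\<^sup>2"
    using s by (simp add: power_mult_distrib)
  finally have "(norm z)\<^sup>2 \<le> (s * sqrt (2 * (1 + 2 * s)) * norm x)\<^sup>2" .
  moreover have "0 \<le> s * sqrt (2 * (1 + 2 * s)) * norm x"
    using s by (intro mult_nonneg_nonneg real_sqrt_ge_zero) auto
  ultimately have "norm z \<le> s * sqrt (2 * (1 + 2 * s)) * norm x"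
    by (rule power2_le_imp_le)
  then show ?thesis
    unfolding s_def x_def .
qed

lemma norm_Fmat_le:
  fixes A :: "real^'n^'n" and B :: "real^'m^'n"
  assumes ctrl: "controllable A B" and Q: "Q \<in> loewner_box \<mu>f lf" and R: "R \<in> loewner_box \<mu>g lg"
    and \<mu>: "0 < \<mu>f" "0 < \<mu>g" and c: "onorm ((*v) (Pe A B Q R)) \<le> c" "\<mu>f \<le> c"
  shows "norm (Fmat A B Q R *v \<theta>)
    \<le> c / \<mu>f * sqrt (2 * (1 + 2 * (c / \<mu>f))) / \<mu>f * onorm ((*v) Q) * norm \<theta>"
proof -
  define P where "P = Pe A B Q R"
  define M where "M = A - B ** riccati_gain A B R P"
  define L where "L = c / \<mu>f * sqrt (2 * (1 + 2 * (c / \<mu>f)))"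
  have R': "pos_def R"
    using R \<mu>(2) by (rule loewner_box_pos_def)
  have P: "psd_mat P" "P = riccati A B Q R P"
    using Pe_DARE_solution[OF ctrl Q R \<mu>] psd_if_pos_def by (auto simp: P_def)
  have decrease: "\<mu>f * (x \<bullet> x) + qform P (M *v x) \<le> qform P x" for x
    unfolding M_def using P R' Q by (rule dare_solution_decrease)
  have upper: "qform P x \<le> c * (x \<bullet> x)" for x
    using qform_le_onorm[of P x] mult_right_mono[OF c(1)[folded P_def] inner_ge_zero[of x]]
    by linarith
  have "norm z \<le> L * norm ((mat 1 - M) *v z)" for z
    unfolding L_def using P(1) decrease upper \<mu>(1) c(2) by (rule norm_le_closed_loop_defect)
  then have closed_loop: "norm (matrix_inv (transpose (mat 1 - M)) *v y) \<le> L * norm y" for y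
    by (intro norm_matrix_inv_le norm_le_transpose_if_norm_le)
  have "\<mu>f * (x \<bullet> x) \<le> qform P x" for x
    using P R' Q by (rule dare_solution_lower)
  then have P_inv: "norm (matrix_inv P *v v) \<le> 1 / \<mu>f * norm v" for v
    using \<mu>(1) by (intro norm_matrix_inv_le norm_le_if_qform_ge)
  have "R + transpose B ** P ** B = control_hessian B R P"
    by (simp add: control_hessian_def add.commute)
  then have "Ke A B Q R = riccati_gain A B R P"
    by (simp add: Ke_def Let_def riccati_gain_def P_def[symmetric])
  then have "Fmat A B Q R *v \<theta> = matrix_inv P *v (matrix_inv (transpose (mat 1 - M)) *v (Q *v \<theta>))"
    by (simp add: Fmat_def M_def P_def transpose_diff matrix_vector_mul_assoc[symmetric])
  also have "norm \<dots> \<le> 1 / \<mu>f * (L * norm (Q *v \<theta>))"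
    using P_inv closed_loop \<mu>(1) by (meson mult_left_mono order.trans zero_le_divide_1_iff less_imp_le)
  also have "\<dots> \<le> 1 / \<mu>f * (L * (onorm ((*v) Q) * norm \<theta>))"
    using \<mu>(1) c(2) by (intro mult_left_mono onorm matrix_vector_mul_bounded_linear) (auto simp: L_def)
  finally show ?thesis
    by (simp add: L_def field_simps)
qed

theorem lemma8:
  fixes A :: "real^'n^'n" and B :: "real^'m^'n"
    and \<mu>f lf \<mu>g lg \<theta>bar :: real
  assumes "\<mu>f > 0" "\<mu>g > 0" "lf > 0" "lg > 0"
    and "controllable A B"
  shows "\<exists>\<beta>bar \<ge> 0. \<forall>Q \<in> loewner_box \<mu>f lf. \<forall>R \<in> loewner_box \<mu>g lg.
           \<forall>\<theta> :: real^'n. norm \<theta> \<le> \<theta>bar \<longrightarrow>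
             max \<theta>bar (norm (Fmat A B Q R *v \<theta>)) \<le> \<beta>bar"
proof -
  obtain C where C: "\<And>Q R. Q \<in> loewner_box \<mu>f lf \<Longrightarrow> R \<in> loewner_box \<mu>g lg \<Longrightarrow>
      onorm ((*v) (Pe A B Q R)) \<le> C"
    using Pe_onorm_bounded[OF assms(5,1,2)] by blast
  obtain CQ where CQ: "\<And>Q :: real^'n^'n. Q \<in> loewner_box \<mu>f lf \<Longrightarrow> onorm ((*v) Q) \<le> CQ"
    using loewner_box_onorm_bounded[OF assms(1)] by blast
  define c where "c = max C \<mu>f"
  define K where "K = c / \<mu>f * sqrt (2 * (1 + 2 * (c / \<mu>f))) / \<mu>f"
  have K: "0 \<le> K"
    using assms(1) by (simp add: K_def c_def)
  have "norm (Fmat A B Q R *v \<theta>) \<le> K * CQ * \<theta>bar"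
    if Q: "Q \<in> loewner_box \<mu>f lf" and R: "R \<in> loewner_box \<mu>g lg" and \<theta>: "norm \<theta> \<le> \<theta>bar" for Q R \<theta>
  proof -
    have "norm (Fmat A B Q R *v \<theta>) \<le> K * onorm ((*v) Q) * norm \<theta>"
      unfolding K_def using C[OF Q R]
      by (intro norm_Fmat_le[OF assms(5) Q R assms(1,2)]) (auto simp: c_def)
    also have "\<dots> \<le> K * CQ * \<theta>bar"
      using K CQ[OF Q] \<theta> order.trans[OF onorm_pos_le[OF matrix_vector_mul_bounded_linear] CQ[OF Q]]
      by (intro mult_mono mult_left_mono onorm_pos_le) auto
    finally show ?thesis .
  qed
  then show ?thesis
    by (intro exI[of _ "max 0 (max \<theta>bar (K * CQ * \<theta>bar))"]) fastforce
qed

end
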